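(* Let $G$ be a group with identity element $1$ and let $E\subseteq G$. Then: (i) $1\in E$ if and only if $\mathbb{M}(E^\star)$ is unital. (ii) $E=E^{-1}$ if and only if $\mathbb{M}(E^\star)$ is self-adjoint. (iii) $E\cdot E\subseteq E$ if and only if $\mathbb{M}(E^\star)$ is an algebra. In particular, $E$ is a subgroup of $G$ if and only if $\mathbb{M}(E^\star)$ is a von Neumann algebra.
   Context: $\ell^2(G)$ is the Hilbert space of square-summable functions $G\to\mathbb{C}$ ($G$ regarded as a discrete group). For $A\subseteq G$, $M_A\in B(\ell^2(G))$ is the projection given by multiplication by the characteristic function $\chi_A$. For $\Omega\subseteq G\times G$, with complement $\Omega^c$ in $G\times G$, $$\mathbb{M}(\Omega)=\{T\in B(\ell^2(G)): M_FTM_E=0\text{ for all }E,F\subseteq G\text{ with }E\times F\subseteq\Omega^c\}.$$ For $E\subseteq G$, $E^\star=\{(g,h)\in G\times G: g^{-1}h\in E\}$, $E^{-1}=\{g^{-1}:g\in E\}$, and $E\cdot E=\{gh:g,h\in E\}$. A subspace of $B(\ell^2(G))$ is unital if it contains the identity operator $I$, and self-adjoint if it is closed under adjoints. A von Neumann algebra on $\ell^2(G)$ contains the identity operator of $B(\ell^2(G))$. *)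

theory Defs
  imports "HOL-Analysis.Analysis" "HOL-Algebra.Coset"
begin

text \<open>
  A square-summable function on a set \<open>S\<close> is represented by its extension by zero to the
  ambient type.  Operators on \<open>ell2 S\<close> are extensional functions (\<open>undefined\<close> outside
  \<open>ell2 S\<close>), so that two operators are equal iff they agree on \<open>ell2 S\<close>.
\<close>

definition ell2 :: "'a set \<Rightarrow> ('a \<Rightarrow> complex) set" where
  "ell2 S = {f. (\<forall>x. x \<notin> S \<longrightarrow> f x = 0) \<and> (\<lambda>x. (cmod (f x))\<^sup>2) summable_on S}"

definition ell2_inner :: "'a set \<Rightarrow> ('a \<Rightarrow> complex) \<Rightarrow> ('a \<Rightarrow> complex) \<Rightarrow> complex" where
  "ell2_inner S f g = (\<Sum>\<^sub>\<infinity>x\<in>S. f x * cnj (g x))"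

definition ell2_norm :: "'a set \<Rightarrow> ('a \<Rightarrow> complex) \<Rightarrow> real" where
  "ell2_norm S f = sqrt (\<Sum>\<^sub>\<infinity>x\<in>S. (cmod (f x))\<^sup>2)"

type_synonym 'a operator = "('a \<Rightarrow> complex) \<Rightarrow> ('a \<Rightarrow> complex)"

definition bounded_ops :: "'a set \<Rightarrow> 'a operator set" where
  "bounded_ops S = {T. T \<in> ell2 S \<rightarrow>\<^sub>E ell2 S \<and>
     (\<forall>f\<in>ell2 S. \<forall>g\<in>ell2 S. T (\<lambda>x. f x + g x) = (\<lambda>x. T f x + T g x)) \<and>
     (\<forall>c. \<forall>f\<in>ell2 S. T (\<lambda>x. c * f x) = (\<lambda>x. c * T f x)) \<and>
     (\<exists>C. \<forall>f\<in>ell2 S. ell2_norm S (T f) \<le> C * ell2_norm S f)}"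

definition op_zero :: "'a set \<Rightarrow> 'a operator" where
  "op_zero S = (\<lambda>f\<in>ell2 S. \<lambda>x. 0)"

definition op_id :: "'a set \<Rightarrow> 'a operator" where
  "op_id S = (\<lambda>f\<in>ell2 S. f)"

definition op_add :: "'a set \<Rightarrow> 'a operator \<Rightarrow> 'a operator \<Rightarrow> 'a operator" where
  "op_add S T R = (\<lambda>f\<in>ell2 S. \<lambda>x. T f x + R f x)"

definition op_scale :: "'a set \<Rightarrow> complex \<Rightarrow> 'a operator \<Rightarrow> 'a operator" where
  "op_scale S c T = (\<lambda>f\<in>ell2 S. \<lambda>x. c * T f x)"

definition op_mult :: "'a set \<Rightarrow> 'a operator \<Rightarrow> 'a operator \<Rightarrow> 'a operator" where
  "op_mult S T R = compose (ell2 S) T R"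

definition op_adjoint :: "'a set \<Rightarrow> 'a operator \<Rightarrow> 'a operator" where
  "op_adjoint S T = (THE R. R \<in> bounded_ops S \<and>
     (\<forall>f\<in>ell2 S. \<forall>g\<in>ell2 S. ell2_inner S (T f) g = ell2_inner S f (R g)))"

definition op_subspace :: "'a set \<Rightarrow> 'a operator set \<Rightarrow> bool" where
  "op_subspace S V \<longleftrightarrow> V \<subseteq> bounded_ops S \<and> op_zero S \<in> V \<and>
     (\<forall>T\<in>V. \<forall>R\<in>V. op_add S T R \<in> V) \<and> (\<forall>c. \<forall>T\<in>V. op_scale S c T \<in> V)"

definition unital_subspace :: "'a set \<Rightarrow> 'a operator set \<Rightarrow> bool" where
  "unital_subspace S V \<longleftrightarrow> op_subspace S V \<and> op_id S \<in> V"

definition selfadjoint_subspace :: "'a set \<Rightarrow> 'a operator set \<Rightarrow> bool" where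
  "selfadjoint_subspace S V \<longleftrightarrow> op_subspace S V \<and> (\<forall>T\<in>V. op_adjoint S T \<in> V)"

definition op_algebra :: "'a set \<Rightarrow> 'a operator set \<Rightarrow> bool" where
  "op_algebra S V \<longleftrightarrow> op_subspace S V \<and> (\<forall>T\<in>V. \<forall>R\<in>V. op_mult S T R \<in> V)"

text \<open>
  The weak operator topology on \<open>bounded_ops S\<close>: the coarsest topology making every
  matrix coefficient \<open>T \<mapsto> \<langle>T f, g\<rangle>\<close> continuous.
\<close>

definition weak_operator_topology :: "'a set \<Rightarrow> 'a operator topology" where
  "weak_operator_topology S = pullback_topology (bounded_ops S)
     (\<lambda>T. \<lambda>(f, g)\<in>ell2 S \<times> ell2 S. ell2_inner S (T f) g)
     (product_topology (\<lambda>_. euclidean) (ell2 S \<times> ell2 S))"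

definition von_neumann_algebra :: "'a set \<Rightarrow> 'a operator set \<Rightarrow> bool" where
  "von_neumann_algebra S V \<longleftrightarrow>
     op_algebra S V \<and> unital_subspace S V \<and> selfadjoint_subspace S V \<and>
     closedin (weak_operator_topology S) V"

definition mult_proj :: "'a set \<Rightarrow> 'a set \<Rightarrow> 'a operator" where
  "mult_proj S A = (\<lambda>f\<in>ell2 S. \<lambda>x. indicator A x * f x)"

definition support_ops :: "'a set \<Rightarrow> ('a \<times> 'a) set \<Rightarrow> 'a operator set" where
  "support_ops S \<Omega> = {T \<in> bounded_ops S. \<forall>A B. A \<subseteq> S \<longrightarrow> B \<subseteq> S \<longrightarrow>
     A \<times> B \<subseteq> S \<times> S - \<Omega> \<longrightarrow>
     op_mult S (mult_proj S B) (op_mult S T (mult_proj S A)) = op_zero S}"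

definition star_set :: "('a, 'b) monoid_scheme \<Rightarrow> 'a set \<Rightarrow> ('a \<times> 'a) set" where
  "star_set G E = {(g, h) \<in> carrier G \<times> carrier G. inv\<^bsub>G\<^esub> g \<otimes>\<^bsub>G\<^esub> h \<in> E}"

end

theory Submission
  imports Defs
begin

text \<open>
  A bounded operator \<open>T\<close> on \<open>\<ell>\<^sup>2(S)\<close> is determined by its matrix, whose entry at \<open>(a, b)\<close> is
  \<open>T (delta a) b\<close>: boundedness gives the expansion of \<open>T f\<close> in entries
  (\<open>matrix_entry_expansion\<close>).  In terms of the matrix, \<open>T\<close> belongs to \<open>support_ops S \<Omega>\<close> exactly
  when all entries outside \<open>\<Omega>\<close> vanish (\<open>support_ops_iff\<close>).  The identity has its nonzero entries
  on the diagonal, the adjoint has the conjugate transposed matrix (\<open>op_adjoint_entry\<close>), and the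
  entries of a product are sums over intermediate points.  Hence, for \<open>\<Omega> \<subseteq> S \<times> S\<close>,
  \<open>support_ops S \<Omega>\<close> is unital, self-adjoint or an algebra if \<open>\<Omega>\<close> is reflexive, symmetric or
  transitive, respectively.  If it is unital, no diagonal entry is forced to vanish, so \<open>\<Omega>\<close> is
  reflexive; for the other two converses, the matrix units at points of \<open>\<Omega>\<close> belong to \<open>support_ops S \<Omega>\<close>, and their adjoints and products are
  matrix units at the reversed and composed points.

  Vanishing of an entry is a weakly closed condition, so \<open>support_ops S \<Omega>\<close> is always weakly
  closed, and it is a von Neumann algebra exactly when \<open>\<Omega>\<close> is an equivalence relation on \<open>S\<close>.  All
  this concerns relations on an arbitrary set.  The group enters only at the end: for the
  relation \<open>g\<inverse> h \<in> E\<close>, reflexivity means \<open>\<one> \<in> E\<close>, symmetry \<open>E = E\<inverse>\<close>, and transitivity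
  \<open>E E \<subseteq> E\<close>.

  Apart from the expansion in entries, the analysis lies in the existence of adjoints
  (\<open>adjoint_exists\<close>), without which the definite description \<open>op_adjoint\<close> has no known value.
\<close>

section \<open>Square-summable functions\<close>

lemma ell2_norm_nonneg: "0 \<le> ell2_norm S f"
  unfolding ell2_norm_def by (simp add: infsum_nonneg)

lemma L2_set_le_ell2_norm:
  assumes "f \<in> ell2 S" "finite F" "F \<subseteq> S"
  shows "L2_set (\<lambda>x. cmod (f x)) F \<le> ell2_norm S f"
  unfolding L2_set_def ell2_norm_def
  using assms by (auto simp: ell2_def intro!: finite_sum_le_infsum)

lemma ell2_by_finite_bounds:
  assumes outside: "\<And>x. x \<notin> S \<Longrightarrow> f x = 0"
    and bound: "\<And>F. finite F \<Longrightarrow> F \<subseteq> S \<Longrightarrow> L2_set (\<lambda>x. cmod (f x)) F \<le> C"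
  shows "f \<in> ell2 S" and "ell2_norm S f \<le> C"
proof -
  have sq: "(\<Sum>x\<in>F. (cmod (f x))\<^sup>2) \<le> C\<^sup>2" if "finite F" "F \<subseteq> S" for F
    using bound[OF that] unfolding L2_set_def by (rule sqrt_le_D)
  have summable: "(\<lambda>x. (cmod (f x))\<^sup>2) summable_on S"
    by (rule nonneg_bdd_above_summable_on) (auto intro!: bdd_aboveI2 sq)
  then show "f \<in> ell2 S"
    using outside by (simp add: ell2_def)
  have "0 \<le> C"
    using bound[of "{}"] by simp
  moreover have "(\<Sum>\<^sub>\<infinity>x\<in>S. (cmod (f x))\<^sup>2) \<le> C\<^sup>2"
    using infsum_le_finite_sums[OF summable sq] .
  ultimately show "ell2_norm S f \<le> C"
    unfolding ell2_norm_def by (intro real_le_lsqrt)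
qed

lemma ell2_add:
  assumes "f \<in> ell2 S" "g \<in> ell2 S"
  shows "(\<lambda>x. f x + g x) \<in> ell2 S"
    and "ell2_norm S (\<lambda>x. f x + g x) \<le> ell2_norm S f + ell2_norm S g"
proof -
  have bound: "L2_set (\<lambda>x. cmod (f x + g x)) F \<le> ell2_norm S f + ell2_norm S g"
    if "finite F" "F \<subseteq> S" for F
  proof -
    have "L2_set (\<lambda>x. cmod (f x + g x)) F \<le> L2_set (\<lambda>x. cmod (f x) + cmod (g x)) F"
      by (rule L2_set_mono) (auto intro: norm_triangle_ineq)
    also have "\<dots> \<le> L2_set (\<lambda>x. cmod (f x)) F + L2_set (\<lambda>x. cmod (g x)) F"
      by (rule L2_set_triangle_ineq)
    also have "\<dots> \<le> ell2_norm S f + ell2_norm S g"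
      using assms that by (intro add_mono L2_set_le_ell2_norm)
    finally show ?thesis .
  qed
  show "(\<lambda>x. f x + g x) \<in> ell2 S"
    and "ell2_norm S (\<lambda>x. f x + g x) \<le> ell2_norm S f + ell2_norm S g"
    using ell2_by_finite_bounds[OF _ bound] assms by (auto simp: ell2_def)
qed

lemma ell2_scale:
  assumes "f \<in> ell2 S"
  shows "(\<lambda>x. c * f x) \<in> ell2 S"
    and "ell2_norm S (\<lambda>x. c * f x) = cmod c * ell2_norm S f"
  using assms
  by (auto simp: ell2_def ell2_norm_def norm_mult power_mult_distrib infsum_cmult_right'
      real_sqrt_mult intro: summable_on_cmult_right)

lemma ell2_zero: "(\<lambda>x. 0) \<in> ell2 S" "ell2_norm S (\<lambda>x. 0) = 0"
  by (simp_all add: ell2_def ell2_norm_def)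

lemma ell2_restrict:
  assumes "f \<in> ell2 S"
  shows "(\<lambda>x. indicator A x * f x) \<in> ell2 S"
proof (rule ell2_by_finite_bounds(1))
  show "L2_set (\<lambda>x. cmod (indicator A x * f x)) F \<le> ell2_norm S f"
    if "finite F" "F \<subseteq> S" for F
  proof -
    have "L2_set (\<lambda>x. cmod (indicator A x * f x)) F \<le> L2_set (\<lambda>x. cmod (f x)) F"
      by (rule L2_set_mono) (auto simp: indicator_def)
    then show ?thesis
      using L2_set_le_ell2_norm[OF assms that] by linarith
  qed
qed (use assms in \<open>auto simp: ell2_def\<close>)

definition delta :: "'a \<Rightarrow> 'a \<Rightarrow> complex" where
  "delta a = indicator {a}"

lemma delta_apply: "delta a x = (if x = a then 1 else 0)"
  by (simp add: delta_def)

lemma delta_ell2: "a \<in> S \<Longrightarrow> delta a \<in> ell2 S"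
  by (auto simp: ell2_def delta_def intro!: finite_nonzero_values_imp_summable_on
      finite_subset[of _ "{a}"] split: split_indicator split_indicator_asm)

lemma ell2_norm_delta:
  assumes "a \<in> S"
  shows "ell2_norm S (delta a) = 1"
proof -
  have "((\<lambda>x. (cmod (delta a x))\<^sup>2) has_sum 1) S"
    by (rule has_sum_finite_neutralI[of "{a}"]) (use assms in \<open>auto simp: delta_def\<close>)
  then show ?thesis
    by (simp add: ell2_norm_def infsumI)
qed

lemma ell2_Cauchy_Schwarz:
  assumes "f \<in> ell2 S" "g \<in> ell2 S"
  shows "(\<lambda>x. cmod (f x * cnj (g x))) summable_on S"
    and "cmod (ell2_inner S f g) \<le> ell2_norm S f * ell2_norm S g"
proof -
  have bound: "(\<Sum>x\<in>F. cmod (f x * cnj (g x))) \<le> ell2_norm S f * ell2_norm S g"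
    if "finite F" "F \<subseteq> S" for F
  proof -
    have "(\<Sum>x\<in>F. cmod (f x * cnj (g x)))
        \<le> L2_set (\<lambda>x. cmod (f x)) F * L2_set (\<lambda>x. cmod (g x)) F"
      using L2_set_mult_ineq[of "\<lambda>x. cmod (f x)" "\<lambda>x. cmod (g x)" F]
      by (simp add: norm_mult)
    also have "\<dots> \<le> ell2_norm S f * ell2_norm S g"
      using assms that
      by (intro mult_mono L2_set_le_ell2_norm L2_set_nonneg ell2_norm_nonneg)
    finally show ?thesis .
  qed
  show summable: "(\<lambda>x. cmod (f x * cnj (g x))) summable_on S"
    by (rule nonneg_bdd_above_summable_on) (auto intro!: bdd_aboveI2 bound)
  show "cmod (ell2_inner S f g) \<le> ell2_norm S f * ell2_norm S g"
    unfolding ell2_inner_def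
    using norm_infsum_bound[OF summable] infsum_le_finite_sums[OF summable bound] by linarith
qed

lemma ell2_inner_summable:
  assumes "f \<in> ell2 S" "g \<in> ell2 S"
  shows "(\<lambda>x. f x * cnj (g x)) summable_on S"
  using ell2_Cauchy_Schwarz(1)[OF assms] by (rule abs_summable_summable)

lemma ell2_inner_add_left:
  assumes "f \<in> ell2 S" "g \<in> ell2 S" "h \<in> ell2 S"
  shows "ell2_inner S (\<lambda>x. f x + g x) h = ell2_inner S f h + ell2_inner S g h"
  unfolding ell2_inner_def distrib_right
  using assms by (intro infsum_add ell2_inner_summable)

lemma ell2_inner_scale_left: "ell2_inner S (\<lambda>x. c * f x) h = c * ell2_inner S f h"
  by (simp add: ell2_inner_def mult.assoc infsum_cmult_right')

lemma ell2_inner_commute: "ell2_inner S g f = cnj (ell2_inner S f g)"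
  by (simp add: ell2_inner_def mult.commute flip: infsum_cnj)

lemma ell2_inner_delta_right:
  assumes "a \<in> S"
  shows "ell2_inner S f (delta a) = f a"
proof -
  have "((\<lambda>x. f x * cnj (delta a x)) has_sum f a) S"
    by (rule has_sum_finite_neutralI[of "{a}"]) (use assms in \<open>auto simp: delta_def\<close>)
  then show ?thesis
    by (simp add: ell2_inner_def infsumI)
qed

lemma ell2_inner_delta_left:
  assumes "a \<in> S"
  shows "ell2_inner S (delta a) f = cnj (f a)"
  using ell2_inner_delta_right[OF assms] ell2_inner_commute by metis

lemma norm_coordinate_le:
  assumes "f \<in> ell2 S" "a \<in> S"
  shows "cmod (f a) \<le> ell2_norm S f"
  using L2_set_le_ell2_norm[OF assms(1), of "{a}"] assms(2) by simp

text \<open>Removing a finite set \<open>F\<close> of coordinates leaves the tail of the series of \<open>\<bar>f\<bar>\<^sup>2\<close>.\<close>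

lemma finite_truncations_converge:
  assumes "f \<in> ell2 S"
  shows "((\<lambda>F. ell2_norm S (\<lambda>x. f x - indicator F x * f x)) \<longlongrightarrow> 0) (finite_subsets_at_top S)"
proof -
  define q where "q = (\<lambda>x. (cmod (f x))\<^sup>2)"
  have q: "q summable_on S"
    using assms by (simp add: ell2_def q_def)
  have "ell2_norm S (\<lambda>x. f x - indicator F x * f x) = sqrt (infsum q S - sum q F)"
    if F: "finite F" "F \<subseteq> S" for F
  proof -
    have "((\<lambda>x. q x - indicator F x * q x) has_sum (infsum q S - sum q F)) S"
    proof -
      have "((\<lambda>x. indicator F x * q x) has_sum sum q F) S"
        by (rule has_sum_finite_neutralI[of F]) (use F in auto)
      from has_sum_add[OF has_sum_infsum[OF q] has_sum_uminusI[OF this]]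
      show ?thesis
        by simp
    qed
    moreover have "(cmod (f x - indicator F x * f x))\<^sup>2 = q x - indicator F x * q x" for x
      by (simp add: q_def indicator_def)
    ultimately show ?thesis
      by (simp add: ell2_norm_def infsumI)
  qed
  then have "\<forall>\<^sub>F F in finite_subsets_at_top S.
      sqrt (infsum q S - sum q F) = ell2_norm S (\<lambda>x. f x - indicator F x * f x)"
    by (intro eventually_finite_subsets_at_top_weakI) simp
  moreover
  have "((\<lambda>F. sqrt (infsum q S - sum q F)) \<longlongrightarrow> sqrt (infsum q S - infsum q S))
      (finite_subsets_at_top S)"
    by (intro tendsto_intros infsum_tendsto q)
  then have "((\<lambda>F. sqrt (infsum q S - sum q F)) \<longlongrightarrow> 0) (finite_subsets_at_top S)"
    by simp
  ultimately show ?thesis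
    by (rule Lim_transform_eventually[rotated])
qed

section \<open>Bounded operators and their matrix entries\<close>

lemma bounded_opsD:
  assumes "T \<in> bounded_ops S"
  shows "f \<in> ell2 S \<Longrightarrow> T f \<in> ell2 S"
    and "f \<in> ell2 S \<Longrightarrow> g \<in> ell2 S \<Longrightarrow> T (\<lambda>x. f x + g x) = (\<lambda>x. T f x + T g x)"
    and "f \<in> ell2 S \<Longrightarrow> T (\<lambda>x. c * f x) = (\<lambda>x. c * T f x)"
    and "f \<notin> ell2 S \<Longrightarrow> T f = undefined"
  using assms by (auto simp: bounded_ops_def PiE_iff extensional_def)

lemma bounded_ops_bound:
  assumes "T \<in> bounded_ops S"
  obtains C where "0 \<le> C" "\<And>f. f \<in> ell2 S \<Longrightarrow> ell2_norm S (T f) \<le> C * ell2_norm S f"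
proof -
  obtain C where C: "\<forall>f\<in>ell2 S. ell2_norm S (T f) \<le> C * ell2_norm S f"
    using assms by (auto simp: bounded_ops_def)
  have "ell2_norm S (T f) \<le> \<bar>C\<bar> * ell2_norm S f" if "f \<in> ell2 S" for f
    using C that mult_right_mono[OF abs_ge_self ell2_norm_nonneg] by (meson order_trans)
  then show thesis
    using that[of "\<bar>C\<bar>"] by simp
qed

lemma bounded_opsI:
  assumes "\<And>f. f \<in> ell2 S \<Longrightarrow> T f \<in> ell2 S"
    and "\<And>f. f \<notin> ell2 S \<Longrightarrow> T f = undefined"
    and "\<And>f g. f \<in> ell2 S \<Longrightarrow> g \<in> ell2 S \<Longrightarrow> T (\<lambda>x. f x + g x) = (\<lambda>x. T f x + T g x)"
    and "\<And>c f. f \<in> ell2 S \<Longrightarrow> T (\<lambda>x. c * f x) = (\<lambda>x. c * T f x)"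
    and "\<And>f. f \<in> ell2 S \<Longrightarrow> ell2_norm S (T f) \<le> C * ell2_norm S f"
  shows "T \<in> bounded_ops S"
  unfolding bounded_ops_def mem_Collect_eq
  by (intro conjI ballI allI exI[of _ C] PiE_I assms)

lemma op_zero_bounded: "op_zero S \<in> bounded_ops S"
  by (rule bounded_opsI[where C = 0]) (auto simp: op_zero_def ell2_zero ell2_add ell2_scale)

lemma op_id_bounded: "op_id S \<in> bounded_ops S"
  by (rule bounded_opsI[where C = 1]) (auto simp: op_id_def ell2_add ell2_scale)

lemma op_add_bounded:
  assumes T: "T \<in> bounded_ops S" and R: "R \<in> bounded_ops S"
  shows "op_add S T R \<in> bounded_ops S"
proof -
  obtain C D where C: "\<And>f. f \<in> ell2 S \<Longrightarrow> ell2_norm S (T f) \<le> C * ell2_norm S f"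
    and D: "\<And>f. f \<in> ell2 S \<Longrightarrow> ell2_norm S (R f) \<le> D * ell2_norm S f"
    using bounded_ops_bound[OF T] bounded_ops_bound[OF R] by metis
  have "ell2_norm S (\<lambda>x. T f x + R f x) \<le> (C + D) * ell2_norm S f" if f: "f \<in> ell2 S" for f
    using ell2_add(2)[OF bounded_opsD(1)[OF T f] bounded_opsD(1)[OF R f]] C[OF f] D[OF f]
    by (simp add: distrib_right)
  then show ?thesis
    by (intro bounded_opsI[where C = "C + D"])
      (auto simp: op_add_def ell2_add ell2_scale bounded_opsD[OF T] bounded_opsD[OF R]
        algebra_simps)
qed

lemma op_scale_bounded:
  assumes T: "T \<in> bounded_ops S"
  shows "op_scale S c T \<in> bounded_ops S"
proof -
  obtain C where C: "\<And>f. f \<in> ell2 S \<Longrightarrow> ell2_norm S (T f) \<le> C * ell2_norm S f"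
    using bounded_ops_bound[OF T] by metis
  have "ell2_norm S (\<lambda>x. c * T f x) \<le> (cmod c * C) * ell2_norm S f" if f: "f \<in> ell2 S" for f
    using mult_left_mono[OF C[OF f], of "cmod c"]
    by (simp add: ell2_scale bounded_opsD[OF T] f mult.assoc)
  then show ?thesis
    by (intro bounded_opsI[where C = "cmod c * C"])
      (auto simp: op_scale_def ell2_add ell2_scale bounded_opsD[OF T] distrib_left
        mult.left_commute)
qed

lemma op_mult_bounded:
  assumes T: "T \<in> bounded_ops S" and R: "R \<in> bounded_ops S"
  shows "op_mult S T R \<in> bounded_ops S"
proof -
  obtain C D where C: "0 \<le> C" "\<And>f. f \<in> ell2 S \<Longrightarrow> ell2_norm S (T f) \<le> C * ell2_norm S f"
    and D: "\<And>f. f \<in> ell2 S \<Longrightarrow> ell2_norm S (R f) \<le> D * ell2_norm S f"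
    using bounded_ops_bound[OF T] bounded_ops_bound[OF R] by metis
  have "ell2_norm S (T (R f)) \<le> (C * D) * ell2_norm S f" if f: "f \<in> ell2 S" for f
    using C(2)[OF bounded_opsD(1)[OF R f]] mult_left_mono[OF D[OF f] C(1)]
    by (simp add: mult.assoc)
  then show ?thesis
    by (intro bounded_opsI[where C = "C * D"])
      (auto simp: op_mult_def compose_def ell2_add ell2_scale bounded_opsD[OF T]
        bounded_opsD[OF R])
qed

text \<open>
  An operator is determined by its values on the functions \<open>delta a\<close>: on finitely supported
  functions by linearity, and in the limit by boundedness, since finite truncations of \<open>f\<close>
  converge to \<open>f\<close> in norm.
\<close>

lemma matrix_coefficient_expansion:
  assumes T: "T \<in> bounded_ops S" and f: "f \<in> ell2 S" and g: "g \<in> ell2 S"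
  shows "((\<lambda>a. f a * ell2_inner S (T (delta a)) g) has_sum ell2_inner S (T f) g) S"
proof -
  define \<phi> where "\<phi> = (\<lambda>h. ell2_inner S (T h) g)"
  obtain C where C: "0 \<le> C" "\<And>h. h \<in> ell2 S \<Longrightarrow> ell2_norm S (T h) \<le> C * ell2_norm S h"
    using bounded_ops_bound[OF T] by metis
  have \<phi>_add: "\<phi> (\<lambda>x. h x + k x) = \<phi> h + \<phi> k" if "h \<in> ell2 S" "k \<in> ell2 S" for h k
    using that g by (simp add: \<phi>_def bounded_opsD[OF T] ell2_inner_add_left)
  have \<phi>_scale: "\<phi> (\<lambda>x. c * h x) = c * \<phi> h" if "h \<in> ell2 S" for c h
    using that by (simp add: \<phi>_def bounded_opsD[OF T] ell2_inner_scale_left)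
  have \<phi>_bound: "cmod (\<phi> h) \<le> C * ell2_norm S g * ell2_norm S h" if h: "h \<in> ell2 S" for h
  proof -
    have "cmod (\<phi> h) \<le> ell2_norm S (T h) * ell2_norm S g"
      unfolding \<phi>_def using bounded_opsD(1)[OF T h] g by (rule ell2_Cauchy_Schwarz(2))
    also have "\<dots> \<le> C * ell2_norm S h * ell2_norm S g"
      using C(2)[OF h] ell2_norm_nonneg by (rule mult_right_mono)
    finally show ?thesis
      by (simp add: mult_ac)
  qed
  have finite_part: "\<phi> (\<lambda>x. indicator F x * f x) = (\<Sum>a\<in>F. f a * \<phi> (delta a))"
    if "finite F" "F \<subseteq> S" for F
    using that
  proof (induction F rule: finite_induct)
    case empty
    show ?case
      using \<phi>_scale[OF ell2_zero(1), of 0] by simp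
  next
    case (insert a F)
    have "(\<lambda>x. indicator (insert a F) x * f x)
        = (\<lambda>x. f a * delta a x + indicator F x * f x)"
      using insert.hyps by (auto simp: delta_def indicator_def)
    moreover have "delta a \<in> ell2 S"
      using insert.prems by (simp add: delta_ell2)
    ultimately show ?case
      using insert by (simp add: \<phi>_add \<phi>_scale ell2_scale ell2_restrict f)
  qed
  have error: "norm ((\<Sum>a\<in>F. f a * \<phi> (delta a)) - \<phi> f)
      \<le> C * ell2_norm S g * ell2_norm S (\<lambda>x. f x - indicator F x * f x)"
    if F: "finite F" "F \<subseteq> S" for F
  proof -
    have rest: "(\<lambda>x. f x - indicator F x * f x) \<in> ell2 S"
      using ell2_add(1)[OF f ell2_scale(1)[OF ell2_restrict[OF f], of "-1" F]] by simp
    have "\<phi> f = \<phi> (\<lambda>x. (f x - indicator F x * f x) + indicator F x * f x)"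
      by simp
    also have "\<dots> = \<phi> (\<lambda>x. f x - indicator F x * f x) + (\<Sum>a\<in>F. f a * \<phi> (delta a))"
      by (simp only: \<phi>_add[OF rest ell2_restrict[OF f]] finite_part[OF F])
    finally show ?thesis
      using \<phi>_bound[OF rest] by (simp add: norm_minus_commute)
  qed
  have "((\<lambda>F. C * ell2_norm S g * ell2_norm S (\<lambda>x. f x - indicator F x * f x)) \<longlongrightarrow> 0)
      (finite_subsets_at_top S)"
    using tendsto_mult_left[OF finite_truncations_converge[OF f]] by simp
  then have "((\<lambda>F. (\<Sum>a\<in>F. f a * \<phi> (delta a)) - \<phi> f) \<longlongrightarrow> 0) (finite_subsets_at_top S)"
    by (rule Lim_null_comparison[rotated])
      (intro eventually_finite_subsets_at_top_weakI error)
  then show ?thesis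
    unfolding has_sum_def \<phi>_def by (rule LIM_zero_cancel)
qed

lemma matrix_entry_expansion:
  assumes "T \<in> bounded_ops S" "f \<in> ell2 S" "b \<in> S"
  shows "((\<lambda>a. f a * T (delta a) b) has_sum T f b) S"
  using matrix_coefficient_expansion[OF assms(1,2) delta_ell2[OF assms(3)]]
  by (simp add: ell2_inner_delta_right assms(3))

definition matrix_unit :: "'a set \<Rightarrow> 'a \<Rightarrow> 'a \<Rightarrow> 'a operator" where
  "matrix_unit S a b = (\<lambda>f\<in>ell2 S. \<lambda>x. f a * delta b x)"

lemma matrix_unit_bounded:
  assumes "a \<in> S" "b \<in> S"
  shows "matrix_unit S a b \<in> bounded_ops S"
  by (rule bounded_opsI[where C = 1])
    (use assms in \<open>auto simp: matrix_unit_def ell2_add ell2_scale delta_ell2 ell2_norm_delta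
      norm_coordinate_le algebra_simps\<close>)

lemma matrix_unit_delta:
  assumes "c \<in> S"
  shows "matrix_unit S a b (delta c) d = (if c = a \<and> d = b then 1 else 0)"
  using assms by (simp add: matrix_unit_def delta_ell2 delta_apply)

section \<open>Adjoints\<close>

text \<open>
  The adjoint is given explicitly: \<open>(R g) a\<close> has to be the inner product of \<open>g\<close> with
  \<open>T (delta a)\<close>.  This function of \<open>a\<close> is square-summable because, for a finite set \<open>F\<close>, its
  squared norm on \<open>F\<close> is the inner product of \<open>T h\<close> and \<open>g\<close> with \<open>h\<close> the restriction of \<open>R g\<close>
  to \<open>F\<close>; by Cauchy--Schwarz it is at most \<open>C\<close> times the norms of \<open>h\<close> and \<open>g\<close>, and one factor
  (the norm of \<open>h\<close>) cancels.
\<close>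

lemma adjoint_exists:
  assumes T: "T \<in> bounded_ops S"
  shows "\<exists>R \<in> bounded_ops S. \<forall>f\<in>ell2 S. \<forall>g\<in>ell2 S. ell2_inner S (T f) g = ell2_inner S f (R g)"
proof -
  define r where "r = (\<lambda>g a. if a \<in> S then ell2_inner S g (T (delta a)) else 0)"
  have Td: "T (delta a) \<in> ell2 S" if "a \<in> S" for a
    using that by (simp add: bounded_opsD[OF T] delta_ell2)
  obtain C where C: "0 \<le> C" "\<And>f. f \<in> ell2 S \<Longrightarrow> ell2_norm S (T f) \<le> C * ell2_norm S f"
    using bounded_ops_bound[OF T] by metis
  have bound: "L2_set (\<lambda>a. cmod (r g a)) F \<le> C * ell2_norm S g"
    if g: "g \<in> ell2 S" and F: "finite F" "F \<subseteq> S" for g F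
  proof -
    define s where "s = L2_set (\<lambda>a. cmod (r g a)) F"
    define h where "h = (\<lambda>a. indicator F a * r g a)"
    have sum_sq: "((\<lambda>a. (cmod (h a))\<^sup>2) has_sum s\<^sup>2) S"
      by (rule has_sum_finite_neutralI[of F])
        (use F in \<open>auto simp: h_def s_def L2_set_def sum_nonneg\<close>)
    have s: "0 \<le> s"
      by (simp add: s_def)
    have h: "h \<in> ell2 S"
      using sum_sq F(2) by (auto simp: ell2_def h_def summable_on_def indicator_def)
    have norm_h: "ell2_norm S h = s"
      using sum_sq s by (simp add: ell2_norm_def infsumI)
    have entries: "ell2_inner S (T (delta a)) g = cnj (r g a)" if "a \<in> S" for a
      using that by (simp add: r_def ell2_inner_commute[of S "T (delta a)" g])
    have "((\<lambda>a. h a * ell2_inner S (T (delta a)) g) has_sum of_real (s\<^sup>2)) S"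
      by (rule has_sum_finite_neutralI[of F])
        (use F in \<open>auto simp: h_def s_def L2_set_def sum_nonneg entries subset_iff
          complex_norm_square simp del: of_real_power intro!: sum.cong\<close>)
    then have "ell2_inner S (T h) g = of_real (s\<^sup>2)"
      using matrix_coefficient_expansion[OF T h g] has_sum_unique by blast
    then have "s\<^sup>2 \<le> ell2_norm S (T h) * ell2_norm S g"
      using ell2_Cauchy_Schwarz(2)[OF bounded_opsD(1)[OF T h] g] by (simp add: norm_power)
    also have "\<dots> \<le> C * s * ell2_norm S g"
      using C(2)[OF h] ell2_norm_nonneg unfolding norm_h by (rule mult_right_mono)
    finally have "s * s \<le> s * (C * ell2_norm S g)"
      by (simp add: power2_eq_square mult_ac)
    then show ?thesis
      using s C(1) ell2_norm_nonneg[of S g] unfolding s_def[symmetric]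
      by (cases "s = 0") simp_all
  qed
  have r_ell2: "r g \<in> ell2 S" "ell2_norm S (r g) \<le> C * ell2_norm S g" if "g \<in> ell2 S" for g
    using ell2_by_finite_bounds[OF _ bound[OF that]] by (auto simp: r_def)
  define R where "R = (\<lambda>g\<in>ell2 S. r g)"
  have "r (\<lambda>x. g x + h x) = (\<lambda>a. r g a + r h a)" if "g \<in> ell2 S" "h \<in> ell2 S" for g h
    using that by (simp add: r_def fun_eq_iff ell2_inner_add_left Td)
  moreover have "r (\<lambda>x. c * g x) = (\<lambda>a. c * r g a)" for c g
    by (simp add: r_def fun_eq_iff ell2_inner_scale_left)
  ultimately have "R \<in> bounded_ops S"
    by (intro bounded_opsI[where C = C]) (simp_all add: R_def r_ell2 ell2_add ell2_scale)
  moreover have "ell2_inner S (T f) g = ell2_inner S f (R g)"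
    if f: "f \<in> ell2 S" and g: "g \<in> ell2 S" for f g
  proof -
    have "ell2_inner S f (R g) = (\<Sum>\<^sub>\<infinity>a\<in>S. f a * ell2_inner S (T (delta a)) g)"
      unfolding ell2_inner_def[of S f]
      by (rule infsum_cong) (simp add: R_def r_def g ell2_inner_commute[of S _ g])
    then show ?thesis
      using infsumI[OF matrix_coefficient_expansion[OF T f g]] by simp
  qed
  ultimately show ?thesis
    by blast
qed

lemma op_adjoint:
  assumes T: "T \<in> bounded_ops S"
  shows "op_adjoint S T \<in> bounded_ops S"
    and "\<And>f g. f \<in> ell2 S \<Longrightarrow> g \<in> ell2 S \<Longrightarrow>
      ell2_inner S (T f) g = ell2_inner S f (op_adjoint S T g)"
proof -
  let ?P = "\<lambda>R. R \<in> bounded_ops S \<and>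
      (\<forall>f\<in>ell2 S. \<forall>g\<in>ell2 S. ell2_inner S (T f) g = ell2_inner S f (R g))"
  have entries: "R g a = cnj (ell2_inner S (T (delta a)) g)"
    if "?P R" "g \<in> ell2 S" "a \<in> S" for R g a
    using that delta_ell2 ell2_inner_delta_left by (metis complex_cnj_cnj)
  have unique: "R = Q" if R: "?P R" and Q: "?P Q" for R Q
  proof (rule ext)
    fix g
    show "R g = Q g"
    proof (cases "g \<in> ell2 S")
      case True
      then have "R g \<in> ell2 S" "Q g \<in> ell2 S"
        using R Q bounded_opsD(1) by blast+
      then have "R g x = Q g x" for x
        unfolding ell2_def mem_Collect_eq using entries[OF R True] entries[OF Q True] by metis
      then show ?thesis
        by (rule ext)
    next
      case False
      then show ?thesis
        using R Q bounded_opsD(4) by metis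
    qed
  qed
  have "\<exists>!R. ?P R"
  proof (rule ex_ex1I)
    show "\<exists>R. ?P R"
      using adjoint_exists[OF T] unfolding Bex_def .
  qed (rule unique)
  then have "?P (THE R. ?P R)"
    by (rule theI')
  then have "?P (op_adjoint S T)"
    unfolding op_adjoint_def .
  then show "op_adjoint S T \<in> bounded_ops S"
    and "\<And>f g. f \<in> ell2 S \<Longrightarrow> g \<in> ell2 S \<Longrightarrow>
      ell2_inner S (T f) g = ell2_inner S f (op_adjoint S T g)"
    by auto
qed

lemma op_adjoint_entry:
  assumes T: "T \<in> bounded_ops S" and "a \<in> S" "b \<in> S"
  shows "op_adjoint S T (delta b) a = cnj (T (delta a) b)"
proof -
  have "cnj (op_adjoint S T (delta b) a) = T (delta a) b"
    using op_adjoint(2)[OF T delta_ell2[OF assms(2)] delta_ell2[OF assms(3)]] assms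
    by (simp add: ell2_inner_delta_left ell2_inner_delta_right)
  then show ?thesis
    by (metis complex_cnj_cnj)
qed

section \<open>Operators supported on a relation\<close>

text \<open>
  Support is a condition on matrix entries: singletons \<open>A\<close>, \<open>B\<close> in the definition pick out one
  entry, and conversely the entries that vanish on \<open>A \<times> B\<close> make the expansion of
  \<open>T (\<chi>\<^sub>A f)\<close> at a point of \<open>B\<close> vanish term by term.
\<close>

lemma support_ops_iff:
  "T \<in> support_ops S \<Omega> \<longleftrightarrow>
     T \<in> bounded_ops S \<and> (\<forall>a\<in>S. \<forall>b\<in>S. (a, b) \<notin> \<Omega> \<longrightarrow> T (delta a) b = 0)"
proof (intro iffI conjI ballI impI)
  assume T: "T \<in> support_ops S \<Omega>"
  then show "T \<in> bounded_ops S"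
    by (simp add: support_ops_def)
  fix a b assume ab: "a \<in> S" "b \<in> S" "(a, b) \<notin> \<Omega>"
  have "op_mult S (mult_proj S {b}) (op_mult S T (mult_proj S {a})) = op_zero S"
    using T ab by (auto simp: support_ops_def)
  then have "op_mult S (mult_proj S {b}) (op_mult S T (mult_proj S {a})) (delta a) b = 0"
    using ab by (simp add: op_zero_def delta_ell2)
  moreover have "(\<lambda>x. indicator {a} x * delta a x) = delta a"
    by (auto simp: delta_def indicator_def)
  ultimately show "T (delta a) b = 0"
    using ab \<open>T \<in> bounded_ops S\<close>
    by (simp add: op_mult_def compose_def mult_proj_def delta_ell2 bounded_opsD)
next
  assume *: "T \<in> bounded_ops S \<and> (\<forall>a\<in>S. \<forall>b\<in>S. (a, b) \<notin> \<Omega> \<longrightarrow> T (delta a) b = 0)"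
  have "op_mult S (mult_proj S B) (op_mult S T (mult_proj S A)) = op_zero S"
    if AB: "A \<subseteq> S" "B \<subseteq> S" "A \<times> B \<subseteq> S \<times> S - \<Omega>" for A B
  proof (rule ext)
    fix f
    have "indicator B b * T (\<lambda>x. indicator A x * f x) b = 0" if f: "f \<in> ell2 S" for b
    proof (cases "b \<in> B")
      case True
      have "((\<lambda>a. indicator A a * f a * T (delta a) b) has_sum
          T (\<lambda>x. indicator A x * f x) b) S"
        using matrix_entry_expansion[of T S "\<lambda>x. indicator A x * f x" b]
          * ell2_restrict[OF f] True AB by auto
      moreover have "((\<lambda>a. indicator A a * f a * T (delta a) b) has_sum 0) S"
        by (rule has_sum_0) (use * AB True in \<open>auto simp: indicator_def\<close>)
      ultimately show ?thesis
        using has_sum_unique by fastforce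
    qed simp
    then show "op_mult S (mult_proj S B) (op_mult S T (mult_proj S A)) f = op_zero S f"
      using * by (auto simp: op_mult_def compose_def mult_proj_def op_zero_def ell2_restrict
          bounded_opsD)
  qed
  then show "T \<in> support_ops S \<Omega>"
    using * by (simp add: support_ops_def)
qed

lemma support_ops_subspace: "op_subspace S (support_ops S \<Omega>)"
proof -
  have "op_zero S (delta a) b = 0"
    and "op_add S T R (delta a) b = T (delta a) b + R (delta a) b"
    and "op_scale S c T (delta a) b = c * T (delta a) b" if "a \<in> S" for T R c a b
    using that by (simp_all add: op_zero_def op_add_def op_scale_def delta_ell2)
  then show ?thesis
    by (auto simp: op_subspace_def support_ops_iff op_zero_bounded op_add_bounded
        op_scale_bounded)
qed

lemma matrix_unit_in_support_ops_iff:
  assumes "a \<in> S" "b \<in> S"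
  shows "matrix_unit S a b \<in> support_ops S \<Omega> \<longleftrightarrow> (a, b) \<in> \<Omega>"
  using assms by (auto simp: support_ops_iff matrix_unit_bounded matrix_unit_delta)

lemma unital_support_ops_iff: "unital_subspace S (support_ops S \<Omega>) \<longleftrightarrow> refl_on S \<Omega>"
proof -
  have "op_id S (delta a) b = (if b = a then 1 else 0)" if "a \<in> S" for a b
    using that by (simp add: op_id_def delta_ell2 delta_apply)
  then show ?thesis
    by (auto simp: unital_subspace_def support_ops_subspace support_ops_iff op_id_bounded
        refl_on_def)
qed

lemma selfadjoint_support_ops_iff:
  assumes "\<Omega> \<subseteq> S \<times> S"
  shows "selfadjoint_subspace S (support_ops S \<Omega>) \<longleftrightarrow> sym \<Omega>"
proof
  assume "sym \<Omega>"
  then have "(b, a) \<in> \<Omega> \<longleftrightarrow> (a, b) \<in> \<Omega>" for a b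
    by (auto dest: symD)
  then have "\<forall>T\<in>support_ops S \<Omega>. op_adjoint S T \<in> support_ops S \<Omega>"
    by (simp add: support_ops_iff op_adjoint op_adjoint_entry)
  then show "selfadjoint_subspace S (support_ops S \<Omega>)"
    by (simp add: selfadjoint_subspace_def support_ops_subspace)
next
  assume adj: "selfadjoint_subspace S (support_ops S \<Omega>)"
  show "sym \<Omega>"
  proof (rule symI, rule ccontr)
    fix a b assume ab: "(a, b) \<in> \<Omega>" "(b, a) \<notin> \<Omega>"
    then have S: "a \<in> S" "b \<in> S"
      using assms by auto
    then have "op_adjoint S (matrix_unit S a b) \<in> support_ops S \<Omega>"
      using adj ab by (simp add: selfadjoint_subspace_def matrix_unit_in_support_ops_iff)
    then have "op_adjoint S (matrix_unit S a b) (delta b) a = 0"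
      using S ab by (simp add: support_ops_iff)
    then show False
      using S by (simp add: op_adjoint_entry matrix_unit_bounded matrix_unit_delta)
  qed
qed

text \<open>
  The entry of \<open>T R\<close> at \<open>(a, b)\<close> is the sum over \<open>c\<close> of the entries of \<open>R\<close> at \<open>(a, c)\<close> and of
  \<open>T\<close> at \<open>(c, b)\<close>, so a nonzero entry gives a path from \<open>a\<close> to \<open>b\<close> through some \<open>c\<close>; matrix
  units show that every such path occurs.
\<close>

lemma algebra_support_ops_iff:
  assumes "\<Omega> \<subseteq> S \<times> S"
  shows "op_algebra S (support_ops S \<Omega>) \<longleftrightarrow> trans \<Omega>"
proof
  assume trans: "trans \<Omega>"
  have "op_mult S T R \<in> support_ops S \<Omega>"
    if TR: "T \<in> support_ops S \<Omega>" "R \<in> support_ops S \<Omega>" for T R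
  proof -
    have T: "T \<in> bounded_ops S" and R: "R \<in> bounded_ops S"
      using TR by (auto simp: support_ops_iff)
    have "T (R (delta a)) b = 0" if ab: "a \<in> S" "b \<in> S" "(a, b) \<notin> \<Omega>" for a b
    proof -
      have "((\<lambda>c. R (delta a) c * T (delta c) b) has_sum T (R (delta a)) b) S"
        using ab by (intro matrix_entry_expansion T bounded_opsD(1)[OF R] delta_ell2)
      moreover have "((\<lambda>c. R (delta a) c * T (delta c) b) has_sum 0) S"
      proof (rule has_sum_0)
        fix c assume "c \<in> S"
        moreover have "(a, c) \<notin> \<Omega> \<or> (c, b) \<notin> \<Omega>"
          using ab trans by (meson transD)
        ultimately show "R (delta a) c * T (delta c) b = 0"
          using TR ab by (auto simp: support_ops_iff)
      qed
      ultimately show ?thesis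
        by (rule has_sum_unique)
    qed
    then show ?thesis
      by (simp add: support_ops_iff op_mult_bounded T R)
        (simp add: op_mult_def compose_def delta_ell2)
  qed
  then show "op_algebra S (support_ops S \<Omega>)"
    by (simp add: op_algebra_def support_ops_subspace)
next
  assume alg: "op_algebra S (support_ops S \<Omega>)"
  show "trans \<Omega>"
  proof (rule transI, rule ccontr)
    fix a c b assume acb: "(a, c) \<in> \<Omega>" "(c, b) \<in> \<Omega>" "(a, b) \<notin> \<Omega>"
    then have S: "a \<in> S" "c \<in> S" "b \<in> S"
      using assms by auto
    then have "op_mult S (matrix_unit S c b) (matrix_unit S a c) \<in> support_ops S \<Omega>"
      using alg acb by (simp add: op_algebra_def matrix_unit_in_support_ops_iff)
    then have "op_mult S (matrix_unit S c b) (matrix_unit S a c) (delta a) b = 0"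
      using S acb by (simp add: support_ops_iff)
    moreover have "matrix_unit S a c (delta a) = delta c"
      using S by (auto simp: matrix_unit_delta fun_eq_iff delta_apply[of c])
    ultimately show False
      using S by (simp add: op_mult_def compose_def delta_ell2 matrix_unit_delta)
  qed
qed

lemma topspace_weak_operator_topology: "topspace (weak_operator_topology S) = bounded_ops S"
  by (auto simp: weak_operator_topology_def topspace_pullback_topology)

lemma continuous_map_matrix_coefficient:
  assumes "f \<in> ell2 S" "g \<in> ell2 S"
  shows "continuous_map (weak_operator_topology S) euclidean (\<lambda>T. ell2_inner S (T f) g)"
proof -
  have "continuous_map (weak_operator_topology S) euclidean
      ((\<lambda>p. p (f, g)) \<circ> (\<lambda>T. \<lambda>(f, g)\<in>ell2 S \<times> ell2 S. ell2_inner S (T f) g))"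
    unfolding weak_operator_topology_def
    by (intro continuous_map_pullback continuous_map_product_projection) (simp add: assms)
  then show ?thesis
    by (simp add: o_def assms)
qed

text \<open>
  Each entry is a matrix coefficient, so the condition that it vanish is weakly closed, and
  \<open>support_ops\<close> is an intersection of such conditions.
\<close>

lemma closedin_support_ops: "closedin (weak_operator_topology S) (support_ops S \<Omega>)"
proof -
  let ?W = "weak_operator_topology S"
  let ?N = "\<lambda>a b. {T \<in> topspace ?W. ell2_inner S (T (delta a)) (delta b) \<in> {0}}"
  let ?\<N> = "{?N a b | a b. a \<in> S \<and> b \<in> S \<and> (a, b) \<notin> \<Omega>}"
  have "closedin ?W (?N a b)" if "a \<in> S" "b \<in> S" for a b
    using that
    by (intro closedin_continuous_map_preimage[OF continuous_map_matrix_coefficient])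
      (auto simp: delta_ell2)
  \<comment> \<open>The extra member \<open>topspace\<close> makes the intersection correct when there are no conditions.\<close>
  then have "closedin ?W (\<Inter>(insert (topspace ?W) ?\<N>))"
    by (intro closedin_Inter) auto
  also have "\<Inter>(insert (topspace ?W) ?\<N>) = support_ops S \<Omega>"
  proof (rule Set.set_eqI)
    fix T
    have "T \<in> \<Inter>(insert (topspace ?W) ?\<N>) \<longleftrightarrow>
        T \<in> topspace ?W \<and> (\<forall>a\<in>S. \<forall>b\<in>S. (a, b) \<notin> \<Omega> \<longrightarrow> T \<in> ?N a b)"
      by blast
    then show "T \<in> \<Inter>(insert (topspace ?W) ?\<N>) \<longleftrightarrow> T \<in> support_ops S \<Omega>"
      by (auto simp: support_ops_iff topspace_weak_operator_topology ell2_inner_delta_right)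
  qed
  finally show ?thesis .
qed

lemma von_neumann_support_ops_iff:
  assumes "\<Omega> \<subseteq> S \<times> S"
  shows "von_neumann_algebra S (support_ops S \<Omega>) \<longleftrightarrow> equiv S \<Omega>"
  using assms by (auto simp: von_neumann_algebra_def equiv_def closedin_support_ops
      unital_support_ops_iff selfadjoint_support_ops_iff algebra_support_ops_iff)

section \<open>The relation of a subset of a group\<close>

lemma star_set_subset: "star_set G E \<subseteq> carrier G \<times> carrier G"
  by (auto simp: star_set_def)

context group
begin

lemma star_set_one_iff:
  assumes "E \<subseteq> carrier G"
  shows "(\<one>, h) \<in> star_set G E \<longleftrightarrow> h \<in> E"
  using assms by (auto simp: star_set_def)

lemma refl_on_star_set_iff: "refl_on (carrier G) (star_set G E) \<longleftrightarrow> \<one> \<in> E"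
  by (auto simp: refl_on_def star_set_def)

text \<open>
  Inverting \<open>g\<inverse> h\<close> interchanges \<open>g\<close> and \<open>h\<close>, and every element of \<open>E\<close> arises from a pair
  starting at the identity.
\<close>

lemma sym_star_set_iff:
  assumes E: "E \<subseteq> carrier G"
  shows "sym (star_set G E) \<longleftrightarrow> E = set_inv E"
proof
  assume sym: "sym (star_set G E)"
  have inv_E: "inv e \<in> E" if e: "e \<in> E" for e
  proof -
    have "(e, \<one>) \<in> star_set G E"
      using sym e by (meson symD star_set_one_iff[OF E])
    then show ?thesis
      using e E by (auto simp: star_set_def)
  qed
  moreover have "e \<in> set_inv E" if "e \<in> E" for e
    using inv_E[OF that] that E by (auto simp: SET_INV_def intro!: bexI[of _ "inv e"])
  ultimately show "E = set_inv E"
    by (auto simp: SET_INV_def)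
next
  assume eq: "E = set_inv E"
  have inv_E: "inv e \<in> E" if "e \<in> E" for e
    using that by (subst eq) (auto simp: SET_INV_def)
  show "sym (star_set G E)"
  proof (rule symI)
    fix g h assume gh: "(g, h) \<in> star_set G E"
    then have "inv (inv g \<otimes> h) \<in> E"
      using inv_E by (simp add: star_set_def)
    then show "(h, g) \<in> star_set G E"
      using gh by (auto simp: star_set_def inv_mult_group)
  qed
qed

text \<open>
  Composing pairs multiplies: \<open>(g\<inverse> h) (h\<inverse> k) = g\<inverse> k\<close>; conversely \<open>x, y \<in> E\<close> give the path
  from the identity through \<open>x\<close> to \<open>x y\<close>.
\<close>

lemma trans_star_set_iff:
  assumes E: "E \<subseteq> carrier G"
  shows "trans (star_set G E) \<longleftrightarrow> E <#> E \<subseteq> E"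
proof
  assume trans: "trans (star_set G E)"
  have "x \<otimes> y \<in> E" if xy: "x \<in> E" "y \<in> E" for x y
  proof -
    have "x \<in> carrier G" "y \<in> carrier G"
      using xy E by auto
    then have "(x, x \<otimes> y) \<in> star_set G E"
      using xy by (simp add: star_set_def m_assoc[symmetric])
    then show ?thesis
      using trans xy by (meson transD star_set_one_iff[OF E])
  qed
  then show "E <#> E \<subseteq> E"
    by (auto simp: set_mult_def)
next
  assume mult: "E <#> E \<subseteq> E"
  show "trans (star_set G E)"
  proof (rule transI)
    fix g h k assume gh: "(g, h) \<in> star_set G E" and hk: "(h, k) \<in> star_set G E"
    then have "(inv g \<otimes> h) \<otimes> (inv h \<otimes> k) \<in> E"
      using mult by (auto simp: star_set_def set_mult_def)
    moreover have "(inv g \<otimes> h) \<otimes> (inv h \<otimes> k) = inv g \<otimes> k"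
      using gh hk by (auto simp: star_set_def m_assoc) (simp flip: m_assoc)
    ultimately show "(g, k) \<in> star_set G E"
      using gh hk by (auto simp: star_set_def)
  qed
qed

lemma equiv_star_set_iff:
  assumes E: "E \<subseteq> carrier G"
  shows "equiv (carrier G) (star_set G E) \<longleftrightarrow> subgroup E G"
proof -
  have "equiv (carrier G) (star_set G E) \<longleftrightarrow> \<one> \<in> E \<and> E = set_inv E \<and> E <#> E \<subseteq> E"
    by (simp add: equiv_def star_set_subset refl_on_star_set_iff sym_star_set_iff[OF E]
        trans_star_set_iff[OF E])
  also have "\<dots> \<longleftrightarrow> subgroup E G"
  proof
    assume *: "\<one> \<in> E \<and> E = set_inv E \<and> E <#> E \<subseteq> E"
    then have "inv e \<in> E" if "e \<in> E" for e
      using that by (auto simp: SET_INV_def)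
    moreover have "x \<otimes> y \<in> E" if "x \<in> E" "y \<in> E" for x y
      using * that by (auto simp: set_mult_def)
    ultimately show "subgroup E G"
      using * E by (intro subgroupI) auto
  next
    assume sub: "subgroup E G"
    have "e \<in> set_inv E" if "e \<in> E" for e
      using that E subgroup.m_inv_closed[OF sub that]
      by (auto simp: SET_INV_def intro!: bexI[of _ "inv e"])
    then show "\<one> \<in> E \<and> E = set_inv E \<and> E <#> E \<subseteq> E"
      using sub by (auto simp: SET_INV_def set_mult_def subgroup.one_closed
          subgroup.m_inv_closed subgroup.m_closed)
  qed
  finally show ?thesis .
qed

end

theorem proposition3p2:
  fixes G :: "('a, 'b) monoid_scheme" and E :: "'a set"
  assumes "group G" and "E \<subseteq> carrier G"
  shows "(\<one>\<^bsub>G\<^esub> \<in> E \<longleftrightarrow> unital_subspace (carrier G) (support_ops (carrier G) (star_set G E)))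
    \<and> (E = set_inv\<^bsub>G\<^esub> E \<longleftrightarrow>
         selfadjoint_subspace (carrier G) (support_ops (carrier G) (star_set G E)))
    \<and> (E <#>\<^bsub>G\<^esub> E \<subseteq> E \<longleftrightarrow>
         op_algebra (carrier G) (support_ops (carrier G) (star_set G E)))
    \<and> (subgroup E G \<longleftrightarrow>
         von_neumann_algebra (carrier G) (support_ops (carrier G) (star_set G E)))"
proof -
  interpret group G
    by (rule assms(1))
  show ?thesis
    by (simp only: unital_support_ops_iff refl_on_star_set_iff
        selfadjoint_support_ops_iff[OF star_set_subset] sym_star_set_iff[OF assms(2)]
        algebra_support_ops_iff[OF star_set_subset] trans_star_set_iff[OF assms(2)]
        von_neumann_support_ops_iff[OF star_set_subset] equiv_star_set_iff[OF assms(2)])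
qed

end
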